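(* Let $P$ be a natural number with $P\equiv 2\pmod 3$. (a) If $P$ and $P+2$ are prime numbers, then there exist relatively prime natural numbers $m$ and $n$ such that $P+1=m=\sqrt{n-1}$. (b) Conversely, if $m$ and $n$ are relatively prime natural numbers with $P+1=m=\sqrt{n-1}$ and $n-2=p_1p_2$ where $p_1$ and $p_2$ are prime numbers, then $P$ and $P+2$ are prime numbers. *)

theory Defs
  imports Complex_Main "HOL-Number_Theory.Cong" "HOL-Computational_Algebra.Primes"
begin

end

theory Submission
  imports Defs
begin

text \<open>The condition \<open>m = sqrt (n - 1)\<close> with \<open>m = P + 1\<close> amounts to
  \<open>n = (P + 1)^2 + 1\<close>, whence \<open>n - 2 = P * (P + 2)\<close>. For (a) this
  \<open>n\<close> is the witness; it is 1 modulo \<open>m\<close>, hence coprime to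
  \<open>m\<close>. For (b), \<open>P * (P + 2) = p1 * p2\<close> with both left factors above 1, so
  unique factorization, in the form of the lemma below, makes them prime.\<close>

lemma primes_if_mult_eq_prime_mult:
  fixes a b p q :: nat
  assumes "prime p" "prime q" "a * b = p * q" "a > 1" "b > 1"
  shows "prime a \<and> prime b"
proof -
  \<comment> \<open>Cancelling \<open>p\<close> leaves \<open>k * y = q\<close> with
    \<open>y > 1\<close>, which forces \<open>k = 1\<close>, so \<open>x = p\<close> and
    \<open>y = q\<close>. Stated for generic \<open>x\<close>, \<open>y\<close> so that it serves
    whichever factor \<open>p\<close> divides.\<close>
  have aux: "prime x \<and> prime y"
    if "p dvd x" and xy: "x * y = p * q" and "y > 1" for x y
  proof -
    obtain k where k: "x = p * k" using \<open>p dvd x\<close> by (elim dvdE)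
    have "k * y = q" using xy k assms(1) by (simp add: mult.assoc)
    with \<open>prime q\<close> \<open>y > 1\<close> have "k = 1"
      by (auto dest: prime_product)
    with k \<open>k * y = q\<close> assms(1,2) show ?thesis by simp
  qed
  have "p dvd a * b" using assms(3) by simp
  then consider "p dvd a" | "p dvd b" using assms(1) prime_dvd_mult_iff by blast
  then show ?thesis
    using aux[of a b] aux[of b a] assms(3-5) by cases (auto simp: mult.commute)
qed

theorem theorem2p3:
  fixes P :: nat
  assumes "[P = 2] (mod 3)"
  shows "(prime P \<and> prime (P + 2) \<longrightarrow>
           (\<exists>m n :: nat. coprime m n \<and> P + 1 = m \<and> real m = sqrt (real n - 1))) \<and>
         (\<forall>m n p1 p2 :: nat.
           coprime m n \<and> P + 1 = m \<and> real m = sqrt (real n - 1) \<and>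
           prime p1 \<and> prime p2 \<and> int n - 2 = int (p1 * p2)
           \<longrightarrow> prime P \<and> prime (P + 2))"
proof (rule conjI; intro impI allI)
  have "coprime (P + 1) ((P + 1) * (P + 1) + 1)"
    by (metis coprime_1_right coprime_iff_gcd_eq_1 gcd_add_mult)
  moreover have "real (P + 1) = sqrt (real ((P + 1) * (P + 1) + 1) - 1)"
    by (intro real_sqrt_unique[symmetric]) (simp_all add: power2_eq_square algebra_simps)
  ultimately show "\<exists>m n :: nat. coprime m n \<and> P + 1 = m \<and> real m = sqrt (real n - 1)"
    by blast
next
  fix m n p1 p2 :: nat
  assume hyp: "coprime m n \<and> P + 1 = m \<and> real m = sqrt (real n - 1) \<and>
    prime p1 \<and> prime p2 \<and> int n - 2 = int (p1 * p2)"
  \<comment> \<open>The residue 2 excludes 0 and 1, so neither \<open>P\<close> nor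
    \<open>P + 2\<close> is a unit or zero.\<close>
  have "P > 1"
  proof -
    have "P mod 3 = 2" using assms by (simp add: cong_def)
    then show ?thesis by presburger
  qed
  have m: "real (P + 1) = sqrt (real n - 1)" and n: "int n - 2 = int (p1 * p2)"
    and p: "prime p1" "prime p2"
    using hyp by auto
  \<comment> \<open>\<open>sqrt\<close> is odd on the reals, so squaring it returns the radicand
    only if that is nonnegative; the positive root ensures this.\<close>
  have "sqrt (real n - 1) > 0" using m by linarith
  then have "real n - 1 = (real (P + 1))\<^sup>2" unfolding m by simp
  then have "real n = real ((P + 1)\<^sup>2 + 1)" by simp
  then have "n = (P + 1)\<^sup>2 + 1" by (simp only: of_nat_eq_iff)
  \<comment> \<open>Here \<open>(P + 1)^2 - 1 = P * (P + 2)\<close>, computed in \<open>int\<close>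
    to avoid truncated subtraction.\<close>
  with n have "int (P * (P + 2)) = int (p1 * p2)"
    by (simp add: power2_eq_square algebra_simps)
  then have "P * (P + 2) = p1 * p2" by (simp only: of_nat_eq_iff)
  then show "prime P \<and> prime (P + 2)"
    using \<open>P > 1\<close> by (intro primes_if_mult_eq_prime_mult[OF p]) simp_all
qed

end
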